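(* For any function $f:\{0,1\}^n\times\{0,1\}^n\to\{0,1\}$ and any deterministic two-party communication protocol tree computing $f$, the garden-hose complexity $GH(f)$ is at most the number of edges of that protocol tree.
   Context: Garden-hose model: Alice holds $x$, Bob holds $y$. A garden-hose protocol of size $s$ consists of a set $V$ of $s$ vertices (pipes) and an extra vertex $t$ (the tap), together with an assignment of a matching $E_A(x)$ on $V\cup\{t\}$ to every input $x$ of Alice and a matching $E_B(y)$ on $V$ to every input $y$ of Bob. In the graph $(V\cup\{t\},E_A(x)\cup E_B(y))$ every vertex has degree at most 2, so there is a unique maximal path starting at $t$ (of length 0 if $t$ is unmatched); the output on $(x,y)$ is the parity of the number of edges of this path. The protocol computes $f$ if the output equals $f(x,y)$ for all $(x,y)$. $GH(f)$ is the minimum size of a garden-hose protocol computing $f$. A deterministic communication protocol is represented by a protocol tree whose internal vertices belong to Alice or Bob, whose edges are labeled by messages, and whose leaves accept or reject.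
   Formalization: The protocol tree consisting of a single accepting leaf is excluded: it computes the constant 1 with 0 edges, whereas a garden-hose protocol without pipes always outputs 0, so GH(1) = 1 and the claim fails for that tree. *)

theory Defs
  imports Main
begin

definition cube :: "nat \<Rightarrow> bool list set" where
  "cube n = {x. length x = n}"

definition matching :: "'v set \<Rightarrow> 'v set set \<Rightarrow> bool" where
  "matching W E \<longleftrightarrow>
     (\<forall>e\<in>E. \<exists>u\<in>W. \<exists>v\<in>W. u \<noteq> v \<and> e = {u, v}) \<and>
     (\<forall>e\<in>E. \<forall>e'\<in>E. e \<noteq> e' \<longrightarrow> e \<inter> e' = {})"

text \<open>A path is given by the list of its vertices, so its number of edges is one less than the
  length of the list.\<close>

definition path_from :: "'v \<Rightarrow> 'v set set \<Rightarrow> 'v list \<Rightarrow> bool" where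
  "path_from t E p \<longleftrightarrow>
     p \<noteq> [] \<and> hd p = t \<and> distinct p \<and> successively (\<lambda>u v. {u, v} \<in> E) p"

definition maximal_path_from :: "'v \<Rightarrow> 'v set set \<Rightarrow> 'v list \<Rightarrow> bool" where
  "maximal_path_from t E p \<longleftrightarrow> path_from t E p \<and> \<not> (\<exists>v. path_from t E (p @ [v]))"

text \<open>Pipes and tap are natural numbers; this loses no generality since only finite vertex sets
  occur. The two assignments are unconstrained outside \<open>cube n\<close>.\<close>

definition gh_protocol ::
    "nat \<Rightarrow> nat set \<Rightarrow> nat \<Rightarrow> (bool list \<Rightarrow> nat set set) \<Rightarrow> (bool list \<Rightarrow> nat set set) \<Rightarrow> bool" where
  "gh_protocol n V t EA EB \<longleftrightarrow>
     finite V \<and> t \<notin> V \<and>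
     (\<forall>x\<in>cube n. matching (insert t V) (EA x)) \<and>
     (\<forall>y\<in>cube n. matching V (EB y))"

definition gh_output ::
    "nat \<Rightarrow> (bool list \<Rightarrow> nat set set) \<Rightarrow> (bool list \<Rightarrow> nat set set) \<Rightarrow>
     bool list \<Rightarrow> bool list \<Rightarrow> bool" where
  "gh_output t EA EB x y \<longleftrightarrow> odd (length (THE p. maximal_path_from t (EA x \<union> EB y) p) - 1)"

definition gh_computes ::
    "nat \<Rightarrow> nat \<Rightarrow> (bool list \<Rightarrow> nat set set) \<Rightarrow> (bool list \<Rightarrow> nat set set) \<Rightarrow>
     (bool list \<Rightarrow> bool list \<Rightarrow> bool) \<Rightarrow> bool" where
  "gh_computes n t EA EB f \<longleftrightarrow>
     (\<forall>x\<in>cube n. \<forall>y\<in>cube n. gh_output t EA EB x y = f x y)"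

definition GH :: "nat \<Rightarrow> (bool list \<Rightarrow> bool list \<Rightarrow> bool) \<Rightarrow> nat" where
  "GH n f = (LEAST s. \<exists>V t EA EB.
     gh_protocol n V t EA EB \<and> card V = s \<and> gh_computes n t EA EB f)"

datatype player = Alice | Bob

text \<open>An internal vertex consists of its owner, the function mapping the owner's input to the
  message sent, and the list of outgoing edges (message label and subtree). Branching is of
  arbitrary finite degree. \<open>Leaf True\<close> accepts and \<open>Leaf False\<close> rejects.\<close>

datatype 'm protocol_tree =
    Leaf bool
  | Node player "bool list \<Rightarrow> 'm" "('m \<times> 'm protocol_tree) list"

primrec wf_tree :: "nat \<Rightarrow> 'm protocol_tree \<Rightarrow> bool" where
  "wf_tree n (Leaf b) \<longleftrightarrow> True"
| "wf_tree n (Node P g cs) \<longleftrightarrow>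
     distinct (map fst cs) \<and>
     g ` cube n \<subseteq> fst ` set cs \<and>
     list_all snd (map (map_prod id (wf_tree n)) cs)"

text \<open>For a well-formed tree the lookup \<open>map_of\<close> always succeeds on inputs from \<open>cube n\<close>.\<close>

primrec tree_output :: "'m protocol_tree \<Rightarrow> bool list \<Rightarrow> bool list \<Rightarrow> bool" where
  "tree_output (Leaf b) = (\<lambda>x y. b)"
| "tree_output (Node P g cs) = (\<lambda>x y.
     the (map_of (map (map_prod id tree_output) cs)
            (g (case P of Alice \<Rightarrow> x | Bob \<Rightarrow> y))) x y)"

definition tree_computes ::
    "nat \<Rightarrow> 'm protocol_tree \<Rightarrow> (bool list \<Rightarrow> bool list \<Rightarrow> bool) \<Rightarrow> bool" where
  "tree_computes n T f \<longleftrightarrow> (\<forall>x\<in>cube n. \<forall>y\<in>cube n. tree_output T x y = f x y)"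

primrec num_edges :: "'m protocol_tree \<Rightarrow> nat" where
  "num_edges (Leaf b) = 0"
| "num_edges (Node P g cs) = sum_list (map (Suc \<circ> snd) (map (map_prod id num_edges) cs))"

lemma matching_unique:
  assumes "matching W E" "{u, v} \<in> E" "{u, w} \<in> E"
  shows "v = w"
proof -
  have "{u, v} \<inter> {u, w} \<noteq> {}" by simp
  then have "{u, v} = {u, w}"
    using assms unfolding matching_def by metis
  then show ?thesis by (auto simp: doubleton_eq_iff)
qed

lemma matching_vertex:
  assumes "matching W E" "{u, v} \<in> E"
  shows "u \<in> W"
proof -
  have "\<exists>a\<in>W. \<exists>b\<in>W. a \<noteq> b \<and> {u, v} = {a, b}"
    using assms unfolding matching_def by simp
  then obtain a b where "a \<in> W" "b \<in> W" "{u, v} = {a, b}" by auto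
  then show ?thesis by (auto simp: doubleton_eq_iff)
qed

lemma path_from_nth:
  assumes "path_from t E p" "Suc i < length p"
  shows "{p ! i, p ! Suc i} \<in> E"
  using assms unfolding path_from_def by (simp add: successively_conv_nth)

lemma path_from_agree:
  assumes A: "matching (insert t V) A" and B: "matching V B" and t: "t \<notin> V"
    and p: "path_from t (A \<union> B) p" and q: "path_from t (A \<union> B) q"
  shows "i < length p \<Longrightarrow> i < length q \<Longrightarrow> p ! i = q ! i"
proof (induction i rule: less_induct)
  case (less i)
  show ?case
  proof (cases i)
    case 0
    with p q show ?thesis unfolding path_from_def by (metis hd_conv_nth)
  next
    case (Suc j)
    let ?u = "p ! j" and ?v = "p ! Suc j" and ?w = "q ! Suc j"
    have pq: "q ! j = ?u" using less.IH[of j] less.prems Suc by simp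
    have v: "{?u, ?v} \<in> A \<union> B" using path_from_nth[OF p] less.prems Suc by simp
    have w: "{?u, ?w} \<in> A \<union> B" using path_from_nth[OF q, of j] less.prems Suc pq by simp
    have "?v = ?w"
    proof (cases j)
      case 0
      then have "?u = t" using p unfolding path_from_def by (metis hd_conv_nth)
      with v w have "{?u, ?v} \<in> A" "{?u, ?w} \<in> A"
        using matching_vertex[OF B] t by auto
      then show ?thesis using matching_unique[OF A] by blast
    next
      case (Suc k)
      let ?z = "p ! k"
      have "q ! k = ?z" using less.IH[of k] less.prems \<open>i = Suc j\<close> Suc by simp
      have z: "{?u, ?z} \<in> A \<union> B"
        using path_from_nth[OF p, of k] less.prems \<open>i = Suc j\<close> Suc by (simp add: insert_commute)
      have "distinct p" "distinct q" using p q unfolding path_from_def by auto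
      have "?v \<noteq> ?z"
        using \<open>distinct p\<close> less.prems \<open>i = Suc j\<close> Suc by (simp add: nth_eq_iff_index_eq)
      moreover have "?w \<noteq> q ! k"
        using \<open>distinct q\<close> less.prems \<open>i = Suc j\<close> Suc by (simp add: nth_eq_iff_index_eq)
      ultimately have "?v \<noteq> ?z" "?w \<noteq> ?z" using \<open>q ! k = ?z\<close> by auto
      with v w z show ?thesis
        using matching_unique[OF A] matching_unique[OF B] by blast
    qed
    then show ?thesis using Suc by simp
  qed
qed

lemma path_from_prefix:
  assumes p: "path_from t E p" and "0 < k"
  shows "path_from t E (take k p)"
  using assms unfolding path_from_def
  by (auto simp: successively_conv_nth hd_take)

lemma path_from_subset:
  assumes A: "matching (insert t V) A" and B: "matching V B" and p: "path_from t (A \<union> B) p"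
  shows "set p \<subseteq> insert t V"
proof
  fix v assume "v \<in> set p"
  then obtain i where i: "i < length p" "v = p ! i" by (auto simp: in_set_conv_nth)
  show "v \<in> insert t V"
  proof (cases i)
    case 0
    then show ?thesis using p i unfolding path_from_def by (metis hd_conv_nth insertI1)
  next
    case (Suc j)
    then have "{v, p ! j} \<in> A \<union> B" using path_from_nth[OF p, of j] i by (simp add: insert_commute)
    then show ?thesis using matching_vertex[OF A] matching_vertex[OF B] by blast
  qed
qed

lemma ex1_maximal_path_from:
  assumes A: "matching (insert t V) A" and B: "matching V B" and t: "t \<notin> V" and V: "finite V"
  shows "\<exists>!p. maximal_path_from t (A \<union> B) p"
proof (rule ex_ex1I)
  let ?P = "path_from t (A \<union> B)"
  have bound: "length p \<le> card (insert t V)" if "?P p" for p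
    using card_mono[OF _ path_from_subset[OF A B that]] V that
    by (simp add: path_from_def distinct_card del: card_insert_disjoint)
  have "?P [t]" by (simp add: path_from_def)
  then have "\<exists>p. ?P p \<and> (\<forall>q. ?P q \<longrightarrow> length q \<le> length p)"
    by (rule ex_has_greatest_nat[where b = "Suc (card (insert t V))"])
      (intro allI impI le_imp_less_Suc bound)
  then obtain p where p: "?P p" and max: "\<And>q. ?P q \<Longrightarrow> length q \<le> length p"
    by auto
  have "\<not> ?P (p @ [v])" for v using max[of "p @ [v]"] by auto
  with p show "\<exists>p. maximal_path_from t (A \<union> B) p" unfolding maximal_path_from_def by blast
next
  have le: "length q \<le> length p"
    if p: "maximal_path_from t (A \<union> B) p" and q: "maximal_path_from t (A \<union> B) q" for p q
  proof (rule ccontr)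
    assume "\<not> length q \<le> length p"
    then have l: "length p < length q" by simp
    have pp: "path_from t (A \<union> B) p" and qq: "path_from t (A \<union> B) q"
      using p q unfolding maximal_path_from_def by auto
    have "take (length p) q = p"
      using path_from_agree[OF A B t pp qq] l by (intro nth_equalityI) auto
    then have "take (Suc (length p)) q = p @ [q ! length p]"
      using l by (simp add: take_Suc_conv_app_nth)
    with path_from_prefix[OF qq, of "Suc (length p)"] p show False
      unfolding maximal_path_from_def by auto
  qed
  fix p q assume p: "maximal_path_from t (A \<union> B) p" and q: "maximal_path_from t (A \<union> B) q"
  have len: "length p = length q" using le[OF p q] le[OF q p] by (rule le_antisym[rotated])
  have pp: "path_from t (A \<union> B) p" and qq: "path_from t (A \<union> B) q"
    using p q unfolding maximal_path_from_def by auto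
  show "p = q"
    using path_from_agree[OF A B t pp qq] len by (intro nth_equalityI) auto
qed

lemma gh_output_eqI:
  assumes "gh_protocol n V t EA EB" "x \<in> cube n" "y \<in> cube n"
    and p: "maximal_path_from t (EA x \<union> EB y) p"
  shows "gh_output t EA EB x y \<longleftrightarrow> odd (length p - 1)"
proof -
  have "\<exists>!p. maximal_path_from t (EA x \<union> EB y) p"
    using assms unfolding gh_protocol_def by (intro ex1_maximal_path_from[of t V]) auto
  then have "(THE p. maximal_path_from t (EA x \<union> EB y) p) = p"
    using p by (rule the1_equality)
  then show ?thesis unfolding gh_output_def by simp
qed

text \<open>A protocol without pipes always outputs 0, whereas the tree consisting of a single accepting
  leaf has no edges. Hence this tree must be excluded from any bound of \<open>GH\<close> by the
  number of edges.\<close>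

lemma GH_const_True: "GH n (\<lambda>x y. True) = 1"
proof -
  let ?Q = "\<lambda>s. \<exists>V t EA EB. gh_protocol n V t EA EB \<and> card V = s \<and>
    gh_computes n t EA EB (\<lambda>x y. True)"
  have zero: "\<not> ?Q 0"
  proof
    assume "?Q 0"
    then obtain V t EA EB where g: "gh_protocol n V t EA EB" "card V = 0"
      and c: "gh_computes n t EA EB (\<lambda>x y. True)" by blast
    then have "V = {}" unfolding gh_protocol_def by simp
    define x where "x = replicate n False"
    have x: "x \<in> cube n" unfolding cube_def x_def by simp
    have "matching {t} (EA x)" "matching {} (EB x)"
      using g(1) x \<open>V = {}\<close> unfolding gh_protocol_def by auto
    then have e: "EA x = {}" "EB x = {}"
      unfolding matching_def by auto
    have "maximal_path_from t (EA x \<union> EB x) [t]"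
      unfolding maximal_path_from_def path_from_def e by simp
    from gh_output_eqI[OF g(1) x x this] c x show False
      unfolding gh_computes_def by simp
  qed
  have one: "?Q 1"
  proof -
    let ?EA = "\<lambda>_ :: bool list. {{0, 1 :: nat}}" and ?EB = "\<lambda>_ :: bool list. {} :: nat set set"
    have g: "gh_protocol n {1} 0 ?EA ?EB"
      unfolding gh_protocol_def matching_def by auto
    have m: "maximal_path_from 0 (?EA x \<union> ?EB y) [0, 1]" for x y :: "bool list"
      unfolding maximal_path_from_def path_from_def by (auto simp: doubleton_eq_iff)
    have "gh_computes n 0 ?EA ?EB (\<lambda>x y. True)"
      unfolding gh_computes_def using gh_output_eqI[OF g _ _ m] by simp
    with g show ?thesis by (intro exI[of _ "{1}"] exI[of _ 0] exI[of _ ?EA] exI[of _ ?EB]) simp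
  qed
  show ?thesis unfolding GH_def
  proof (rule Least_equality[of ?Q, OF one])
    fix s assume "?Q s"
    with zero have "s \<noteq> 0" by (cases "s = 0") blast+
    then show "1 \<le> s" by simp
  qed
qed

end

theory Submission
  imports Defs
begin

text \<open>The proof rests on two operations. Prepending a fresh pipe to the tap exchanges the roles of
  the players and negates the output, at the cost of one pipe. Gluing protocols together at their
  taps lets Alice choose which of them is executed, at the cost of the sum of the sizes. For an inner
  node \<open>T\<close> with \<open>e\<close> edges whose function is not constant, one obtains from the protocols of its
  children a protocol with at most \<open>e - 1\<close> pipes when the tap is held by the owner of \<open>T\<close>: a child
  with \<open>e'\<close> edges contributes at most \<open>e' + 1\<close> pipes, and at most \<open>e'\<close> unless its function is the
  constant that requires a pipe, which cannot be the case for all children. If the other player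
  holds the tap, one more pipe suffices.\<close>

text \<open>Quantifying over the tap and over a finite set of forbidden vertices allows one to combine
  protocols without renaming vertices.\<close>

definition hose_computable :: "nat \<Rightarrow> (bool list \<Rightarrow> bool list \<Rightarrow> bool) \<Rightarrow> nat \<Rightarrow> bool" where
  "hose_computable n f s \<longleftrightarrow>
     (\<forall>t F. finite F \<longrightarrow>
       (\<exists>V EA EB. gh_protocol n V t EA EB \<and> V \<inter> F = {} \<and> card V \<le> s \<and>
          (\<forall>x\<in>cube n. \<forall>y\<in>cube n.
             \<exists>p. maximal_path_from t (EA x \<union> EB y) p \<and> (odd (length p - 1) \<longleftrightarrow> f x y))))"

lemma hose_computableE:
  assumes "hose_computable n f s" "finite F"
  obtains V EA EB where "gh_protocol n V t EA EB" "V \<inter> F = {}" "card V \<le> s"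
    "\<And>x y. x \<in> cube n \<Longrightarrow> y \<in> cube n \<Longrightarrow>
      \<exists>p. maximal_path_from t (EA x \<union> EB y) p \<and> (odd (length p - 1) \<longleftrightarrow> f x y)"
  using assms unfolding hose_computable_def by meson

lemma hose_computable_mono: "hose_computable n f s \<Longrightarrow> s \<le> s' \<Longrightarrow> hose_computable n f s'"
  unfolding hose_computable_def by (fast intro: order_trans)

lemma hose_computable_cong:
  assumes "hose_computable n f s" "\<And>x y. x \<in> cube n \<Longrightarrow> y \<in> cube n \<Longrightarrow> f x y = f' x y"
  shows "hose_computable n f' s"
  using assms unfolding hose_computable_def by simp

lemma GH_le:
  assumes "hose_computable n f s"
  shows "GH n f \<le> s"
proof -
  obtain V EA EB where g: "gh_protocol n V 0 EA EB" and s: "card V \<le> s"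
    and p: "\<And>x y. x \<in> cube n \<Longrightarrow> y \<in> cube n \<Longrightarrow>
      \<exists>p. maximal_path_from 0 (EA x \<union> EB y) p \<and> (odd (length p - 1) \<longleftrightarrow> f x y)"
    by (rule hose_computableE[where t = 0, OF assms finite.emptyI]) blast
  have "gh_computes n 0 EA EB f"
    unfolding gh_computes_def using p gh_output_eqI[OF g] by blast
  with g have "GH n f \<le> card V"
    unfolding GH_def by (intro Least_le) blast
  with s show ?thesis by simp
qed

section \<open>Matchings and maximal paths in enlarged graphs\<close>

lemma matching_Un:
  assumes "matching U A" "matching W B" "U \<inter> W = {}"
  shows "matching (U \<union> W) (A \<union> B)"
proof -
  have A: "e \<subseteq> U" if "e \<in> A" for e using assms(1) that unfolding matching_def by fastforce
  have B: "e \<subseteq> W" if "e \<in> B" for e using assms(2) that unfolding matching_def by fastforce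
  have "\<forall>e\<in>A. \<forall>e'\<in>B. e \<inter> e' = {}" using A B assms(3) by blast
  with assms(1,2) show ?thesis unfolding matching_def
    by (simp add: ball_Un) (metis UnCI inf_commute)
qed

lemma matching_remove:
  assumes "matching (insert t V) E"
  shows "matching V {e \<in> E. t \<notin> e}"
  using assms unfolding matching_def by (auto; metis insertI1 insert_commute)

text \<open>The end of \<open>p\<close> lies in \<open>U\<close>, where no edge of \<open>E'\<close>
  is incident, so the additional edges cannot prolong the path. In gluing, \<open>E'\<close> is a
  matching of the protocol that is not executed.\<close>

lemma maximal_path_from_extend:
  assumes p: "maximal_path_from t E p" "set p \<subseteq> U"
    and W: "matching W E'" "U \<inter> W = {}"
  shows "maximal_path_from t (E \<union> E') p"
proof -
  have pp: "path_from t E p" using p unfolding maximal_path_from_def by simp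
  then have "p \<noteq> []" unfolding path_from_def by simp
  then have "last p \<notin> W" using p(2) W(2) last_in_set by blast
  then have "{last p, v} \<notin> E'" for v using matching_vertex[OF W(1)] by blast
  then have "path_from t E (p @ [v])" if "path_from t (E \<union> E') (p @ [v])" for v
    using that pp unfolding path_from_def by (auto simp: successively_append_iff)
  moreover have "path_from t (E \<union> E') p"
    using pp unfolding path_from_def by (auto elim: successively_mono)
  ultimately show ?thesis using p(1) unfolding maximal_path_from_def by blast
qed

text \<open>The only edge added contains \<open>t\<close>, which the longer path has already
  visited, so it does not prolong the path at its far end.\<close>

lemma maximal_path_from_Cons:
  assumes p: "maximal_path_from u E p" and t: "t \<notin> set p"
  shows "maximal_path_from t (insert {t, u} E) (t # p)"
proof -
  have pp: "p \<noteq> []" "hd p = u" "distinct p" "successively (\<lambda>u v. {u, v} \<in> E) p"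
    using p unfolding maximal_path_from_def path_from_def by auto
  have "path_from t (insert {t, u} E) (t # p)"
    using pp t unfolding path_from_def by (auto simp: successively_Cons elim: successively_mono)
  moreover have "path_from u E (p @ [v])" if "path_from t (insert {t, u} E) (t # p @ [v])" for v
  proof -
    have "{last p, v} \<in> insert {t, u} E" "v \<notin> insert t (set p)"
      using that pp unfolding path_from_def
      by (auto simp: successively_Cons successively_append_iff)
    moreover have "last p \<noteq> t" using t pp(1) last_in_set by metis
    ultimately have "{last p, v} \<in> E" by (auto simp: doubleton_eq_iff)
    with pp \<open>v \<notin> insert t (set p)\<close> show ?thesis
      unfolding path_from_def by (auto simp: successively_append_iff)
  qed
  ultimately show ?thesis using p unfolding maximal_path_from_def by auto
qed

lemma gh_protocol_path_subset:
  assumes "gh_protocol n V t EA EB" "x \<in> cube n" "y \<in> cube n"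
    and "maximal_path_from t (EA x \<union> EB y) p"
  shows "set p \<subseteq> insert t V"
  using assms path_from_subset[of t V "EA x" "EB y" p]
  unfolding gh_protocol_def maximal_path_from_def by blast

section \<open>Operations on garden-hose protocols\<close>

lemma hose_computable_False: "hose_computable n (\<lambda>x y. False) 0"
  unfolding hose_computable_def
proof (intro allI impI)
  fix t :: nat and F :: "nat set"
  have "maximal_path_from t {} [t]" unfolding maximal_path_from_def path_from_def by simp
  then show "\<exists>V EA EB. gh_protocol n V t EA EB \<and> V \<inter> F = {} \<and> card V \<le> 0 \<and>
    (\<forall>x\<in>cube n. \<forall>y\<in>cube n.
       \<exists>p. maximal_path_from t (EA x \<union> EB y) p \<and> (odd (length p - 1) \<longleftrightarrow> False))"
    by (intro exI[of _ "{}"] exI[of _ "\<lambda>_. {}"]) (auto simp: gh_protocol_def matching_def)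
qed

lemma hose_computable_swap:
  assumes "hose_computable n f s"
  shows "hose_computable n (\<lambda>x y. \<not> f y x) (Suc s)"
  unfolding hose_computable_def
proof (intro allI impI)
  fix t :: nat and F :: "nat set"
  assume F: "finite F"
  then obtain u where u: "u \<notin> insert t F"
    using ex_new_if_finite[OF infinite_UNIV_nat] by (metis finite_insert)
  obtain V EA EB where g: "gh_protocol n V u EA EB" and VF: "V \<inter> insert t F = {}"
    and s: "card V \<le> s"
    and path: "\<And>x y. x \<in> cube n \<Longrightarrow> y \<in> cube n \<Longrightarrow>
      \<exists>p. maximal_path_from u (EA x \<union> EB y) p \<and> (odd (length p - 1) \<longleftrightarrow> f x y)"
    using hose_computableE[OF assms] F by (metis finite_insert)
  \<comment> \<open>The players exchange their matchings. \<open>EB x\<close> does not touch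
    \<open>u\<close>, so Alice can add the edge between \<open>t\<close> and \<open>u\<close>, while
    Bob's \<open>EA\<close> may use \<open>u\<close> as an ordinary pipe.\<close>
  let ?V = "insert u V" and ?EA = "\<lambda>x. {{t, u}} \<union> EB x" and ?EB = EA
  have "matching {t, u} {{t, u}}" using u unfolding matching_def by auto
  then have "matching (insert t ?V) (?EA x)" if "x \<in> cube n" for x
    using matching_Un[of "{t, u}" "{{t, u}}" V "EB x"] g VF that unfolding gh_protocol_def by auto
  then have "gh_protocol n ?V t ?EA ?EB"
    using g u VF unfolding gh_protocol_def by auto
  moreover have "?V \<inter> F = {}" "card ?V \<le> Suc s"
    using u VF s g card_insert_le_m1[of "Suc s" V u] unfolding gh_protocol_def by auto
  moreover have "\<exists>p. maximal_path_from t (?EA x \<union> ?EB y) p \<and> (odd (length p - 1) \<longleftrightarrow> \<not> f y x)"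
    if xy: "x \<in> cube n" "y \<in> cube n" for x y
  proof -
    obtain p where p: "maximal_path_from u (EA y \<union> EB x) p" "odd (length p - 1) \<longleftrightarrow> f y x"
      using path xy by blast
    have "t \<notin> set p" using gh_protocol_path_subset[OF g xy(2,1) p(1)] u VF by auto
    from maximal_path_from_Cons[OF p(1) this]
    have "maximal_path_from t (?EA x \<union> ?EB y) (t # p)" by (simp add: Un_commute)
    moreover have "p \<noteq> []" using p(1) unfolding maximal_path_from_def path_from_def by simp
    ultimately show ?thesis using p(2) by (intro exI[of _ "t # p"]) (cases p; auto)
  qed
  ultimately show "\<exists>V EA EB. gh_protocol n V t EA EB \<and> V \<inter> F = {} \<and> card V \<le> Suc s \<and>
    (\<forall>x\<in>cube n. \<forall>y\<in>cube n.
       \<exists>p. maximal_path_from t (EA x \<union> EB y) p \<and> (odd (length p - 1) \<longleftrightarrow> \<not> f y x))"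
    by blast
qed

lemma hose_computable_if:
  assumes f: "hose_computable n f s" and h: "hose_computable n h r"
  shows "hose_computable n (\<lambda>x y. if P x then f x y else h x y) (s + r)"
  unfolding hose_computable_def
proof (intro allI impI)
  fix t :: nat and F :: "nat set"
  assume F: "finite F"
  obtain V A B where g1: "gh_protocol n V t A B" and VF: "V \<inter> F = {}" and s: "card V \<le> s"
    and path1: "\<And>x y. x \<in> cube n \<Longrightarrow> y \<in> cube n \<Longrightarrow>
      \<exists>p. maximal_path_from t (A x \<union> B y) p \<and> (odd (length p - 1) \<longleftrightarrow> f x y)"
    by (rule hose_computableE[where t = t, OF f F]) blast
  \<comment> \<open>Forbidding \<open>V\<close> for the second protocol makes the tap the only
    common vertex.\<close>
  have "finite (V \<union> F)" using F g1 unfolding gh_protocol_def by simp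
  then obtain W C D where g2: "gh_protocol n W t C D" and WF: "W \<inter> (V \<union> F) = {}" and r: "card W \<le> r"
    and path2: "\<And>x y. x \<in> cube n \<Longrightarrow> y \<in> cube n \<Longrightarrow>
      \<exists>p. maximal_path_from t (C x \<union> D y) p \<and> (odd (length p - 1) \<longleftrightarrow> h x y)"
    by (rule hose_computableE[where t = t, OF h]) blast
  \<comment> \<open>Alice keeps the tap's edge of the chosen protocol only. Bob, who does not know
    \<open>P x\<close>, plays both of his matchings.\<close>
  let ?A = "\<lambda>x. {e \<in> A x. t \<notin> e}" and ?C = "\<lambda>x. {e \<in> C x. t \<notin> e}"
  let ?EA = "\<lambda>x. if P x then A x \<union> ?C x else C x \<union> ?A x" and ?EB = "\<lambda>y. B y \<union> D y"
  have mA: "matching (insert t V) (A x)" "matching V (?A x)"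
    and mC: "matching (insert t W) (C x)" "matching W (?C x)"
    and mB: "matching V (B x)" and mD: "matching W (D x)" if "x \<in> cube n" for x
    using g1 g2 that unfolding gh_protocol_def by (blast intro: matching_remove)+
  have t: "t \<notin> V" "t \<notin> W" and VW: "V \<inter> W = {}" "W \<inter> V = {}"
    using g1 g2 WF unfolding gh_protocol_def by auto
  then have dis: "insert t V \<inter> W = {}" "insert t W \<inter> V = {}" by auto
  have "matching (insert t (V \<union> W)) (?EA x)" if "x \<in> cube n" for x
    using matching_Un[OF mA(1) mC(2) dis(1), of x x] matching_Un[OF mC(1) mA(2) dis(2), of x x] that
    by (auto simp: Un_commute)
  moreover have "matching (V \<union> W) (?EB y)" if "y \<in> cube n" for y
    using matching_Un[OF mB[OF that] mD[OF that] VW(1)] .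
  ultimately have "gh_protocol n (V \<union> W) t ?EA ?EB"
    using g1 g2 t unfolding gh_protocol_def by auto
  moreover have "(V \<union> W) \<inter> F = {}" "card (V \<union> W) \<le> s + r"
    using VF WF s r card_Un_le[of V W] by auto
  moreover have "\<exists>p. maximal_path_from t (?EA x \<union> ?EB y) p \<and>
      (odd (length p - 1) \<longleftrightarrow> (if P x then f x y else h x y))"
    if xy: "x \<in> cube n" "y \<in> cube n" for x y
  proof (cases "P x")
    case True
    obtain p where p: "maximal_path_from t (A x \<union> B y) p" "odd (length p - 1) \<longleftrightarrow> f x y"
      using path1 xy by blast
    \<comment> \<open>The edges of the idle protocol are added in two steps, first Alice's and then
      Bob's. Both are matchings on \<open>W\<close>, which the path avoids.\<close>
    have "maximal_path_from t ((A x \<union> B y) \<union> ?C x \<union> D y) p"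
      by (intro maximal_path_from_extend[OF maximal_path_from_extend, OF p(1) _ mC(2) dis(1) _ mD dis(1)]
          gh_protocol_path_subset[OF g1 xy p(1)] xy)
    then have "maximal_path_from t (?EA x \<union> ?EB y) p"
      using True by (simp add: Un_ac)
    with p(2) True show ?thesis by auto
  next
    case False
    obtain p where p: "maximal_path_from t (C x \<union> D y) p" "odd (length p - 1) \<longleftrightarrow> h x y"
      using path2 xy by blast
    have "maximal_path_from t ((C x \<union> D y) \<union> ?A x \<union> B y) p"
      by (intro maximal_path_from_extend[OF maximal_path_from_extend, OF p(1) _ mA(2) dis(2) _ mB dis(2)]
          gh_protocol_path_subset[OF g2 xy p(1)] xy)
    then have "maximal_path_from t (?EA x \<union> ?EB y) p"
      using False by (simp add: Un_ac)
    with p(2) False show ?thesis by auto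
  qed
  ultimately show "\<exists>V EA EB. gh_protocol n V t EA EB \<and> V \<inter> F = {} \<and> card V \<le> s + r \<and>
    (\<forall>x\<in>cube n. \<forall>y\<in>cube n. \<exists>p. maximal_path_from t (EA x \<union> EB y) p \<and>
       (odd (length p - 1) \<longleftrightarrow> (if P x then f x y else h x y)))"
    by blast
qed

text \<open>Alice selects the children one after the other by \<open>hose_computable_if\<close>. The
  default value is \<open>False\<close> because this constant needs no pipe.\<close>

lemma hose_computable_lookup:
  assumes "\<And>m c. (m, c) \<in> set cs \<Longrightarrow> hose_computable n (F c) (s c)"
  shows "hose_computable n (\<lambda>x y. case map_of cs (g x) of None \<Rightarrow> False | Some c \<Rightarrow> F c x y)
    (\<Sum>(m, c)\<leftarrow>cs. s c)"
  using assms
proof (induction cs)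
  case Nil
  show ?case using hose_computable_False by simp
next
  case (Cons mc cs)
  obtain m c where mc: "mc = (m, c)" by fastforce
  have "hose_computable n (F c) (s c)"
    and "hose_computable n (\<lambda>x y. case map_of cs (g x) of None \<Rightarrow> False | Some c \<Rightarrow> F c x y)
      (\<Sum>(m, c)\<leftarrow>cs. s c)"
    using Cons mc by auto
  from hose_computable_if[OF this, where P = "\<lambda>x. g x = m"]
  show ?case by (rule hose_computable_cong[THEN hose_computable_mono]) (auto simp: mc)
qed

section \<open>Changing the player who holds the tap\<close>

text \<open>The function to be computed by a garden-hose protocol whose tap is held by player \<open>P\<close>, up to
  exchanging the players: if Bob holds the tap, this is an ordinary protocol entered through one
  additional pipe, so the parity is flipped.\<close>

definition oriented ::
    "player \<Rightarrow> (bool list \<Rightarrow> bool list \<Rightarrow> bool) \<Rightarrow> bool list \<Rightarrow> bool list \<Rightarrow> bool" where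
  "oriented P f x y \<longleftrightarrow> (case P of Alice \<Rightarrow> f x y | Bob \<Rightarrow> \<not> f y x)"

definition constant_on_cube :: "nat \<Rightarrow> (bool list \<Rightarrow> bool list \<Rightarrow> bool) \<Rightarrow> bool" where
  "constant_on_cube n f \<longleftrightarrow> (\<exists>b. \<forall>x\<in>cube n. \<forall>y\<in>cube n. f x y = b)"

lemma constant_on_cube_oriented: "constant_on_cube n (oriented P f) \<longleftrightarrow> constant_on_cube n f"
  unfolding constant_on_cube_def oriented_def by (cases P) (simp; metis)+

text \<open>Both orientations arise from each other by the same involution, which
  \<open>hose_computable_swap\<close> realizes, so one pipe suffices in either direction.\<close>

lemma hose_computable_oriented:
  assumes "hose_computable n (oriented P f) s"
  shows "hose_computable n (oriented Q f) (Suc s)"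
proof (cases "P = Q")
  case True
  with assms show ?thesis by (auto elim: hose_computable_mono)
next
  case False
  from hose_computable_swap[OF assms] show ?thesis
    by (rule hose_computable_cong) (use False in \<open>cases P; cases Q; simp add: oriented_def\<close>)
qed

lemma hose_computable_constant:
  assumes "constant_on_cube n f"
  shows "hose_computable n f (if \<forall>x\<in>cube n. \<forall>y\<in>cube n. f x y then 1 else 0)"
proof (cases "\<forall>x\<in>cube n. \<forall>y\<in>cube n. f x y")
  case True
  from hose_computable_swap[OF hose_computable_False] have "hose_computable n f (Suc 0)"
    by (rule hose_computable_cong) (use True in simp)
  with True show ?thesis by simp
next
  case False
  from hose_computable_False have "hose_computable n f 0"
    by (rule hose_computable_cong) (use False assms in \<open>auto simp: constant_on_cube_def\<close>)
  with False show ?thesis by (simp only: if_False)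
qed

text \<open>Bounds what a subtree with \<open>e\<close> edges contributes to its parent owned by
  \<open>Q\<close>. In the second case \<open>s < e\<close> pays for moving the tap to
  \<open>Q\<close>. In the first, at most one pipe is needed, and only for the constant
  true.\<close>

lemma hose_computable_slack:
  assumes "constant_on_cube n f \<or> (\<exists>P s. s < e \<and> hose_computable n (oriented P f) s)"
  shows "hose_computable n (oriented Q f)
    (if \<forall>x\<in>cube n. \<forall>y\<in>cube n. oriented Q f x y then Suc e else e)"
  using assms
proof
  assume "constant_on_cube n f"
  then have "constant_on_cube n (oriented Q f)" by (simp add: constant_on_cube_oriented)
  from hose_computable_constant[OF this] show ?thesis
    by (rule hose_computable_mono) simp
next
  assume "\<exists>P s. s < e \<and> hose_computable n (oriented P f) s"
  then obtain P s where s: "s < e" "hose_computable n (oriented P f) s" by blast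
  from hose_computable_oriented[OF s(2)] show ?thesis
    by (rule hose_computable_mono) (use s(1) in simp)
qed

section \<open>Induction over the protocol tree\<close>

lemma num_edges_Node: "num_edges (Node P g cs) = (\<Sum>(m, c)\<leftarrow>cs. Suc (num_edges c))"
  by (simp add: comp_def case_prod_unfold)

lemma tree_output_Node:
  assumes "map_of cs (g (case P of Alice \<Rightarrow> x | Bob \<Rightarrow> y)) = Some c"
  shows "tree_output (Node P g cs) x y = tree_output c x y"
proof -
  \<comment> \<open>The recursion evaluates the children before the lookup; mapping the values
    commutes with \<open>map_of\<close>.\<close>
  have "map_of (map (map_prod id h) cs) = map_option h \<circ> map_of cs"
    for h :: "_ \<Rightarrow> bool list \<Rightarrow> bool list \<Rightarrow> bool"
    by (induction cs) auto
  then show ?thesis using assms by simp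
qed

text \<open>The strict inequality makes the induction work: the pipe saved in a child pays for
  passing the tap to the owner of the parent. Constants are set apart since a leaf has no edge to
  save.\<close>

lemma protocol_tree_slack:
  assumes "wf_tree n T"
  shows "constant_on_cube n (tree_output T) \<or>
    (\<exists>P s. s < num_edges T \<and> hose_computable n (oriented P (tree_output T)) s)"
  using assms
proof (induction T)
  case (Leaf b)
  show ?case by (simp add: constant_on_cube_def)
next
  case (Node P g cs)
  let ?F = "\<lambda>c. oriented P (tree_output c)"
  let ?true = "\<lambda>c. \<forall>x\<in>cube n. \<forall>y\<in>cube n. ?F c x y"
  let ?s = "\<lambda>c. if ?true c then Suc (num_edges c) else num_edges c"
  have child: "hose_computable n (?F c) (?s c)" if "(m, c) \<in> set cs" for m c
    using that Node.prems by (intro hose_computable_slack Node.IH[of "(m, c)"])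
      (auto simp: list_all_iff)
  have dom: "\<exists>c. map_of cs (g x) = Some c" if "x \<in> cube n" for x
    using Node.prems that by (fastforce simp flip: dom_map_of_conv_image_fst)
  \<comment> \<open>For either owner \<open>P\<close>, the first argument of \<open>?F\<close> is
    the input of \<open>P\<close>, so the choice of the child depends on \<open>x\<close>
    alone.\<close>
  have F: "?F (Node P g cs) x y = ?F c x y" if "map_of cs (g x) = Some c" for x y c
    using that tree_output_Node[of cs g _ _ P]
    by (cases P) (simp_all add: oriented_def del: tree_output.simps)
  show ?case
  proof (cases "\<forall>(m, c)\<in>set cs. ?true c")
    case True
    have "?F (Node P g cs) x y" if "x \<in> cube n" "y \<in> cube n" for x y
      using dom[OF that(1)] F True that by (force dest: map_of_SomeD)
    then have "constant_on_cube n (?F (Node P g cs))" unfolding constant_on_cube_def by blast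
    then show ?thesis unfolding constant_on_cube_oriented by (rule disjI1)
  next
    case False
    then obtain m c where c: "(m, c) \<in> set cs" "\<not> ?true c" by blast
    then obtain cs1 cs2 where cs: "cs = cs1 @ (m, c) # cs2" by (meson split_list)
    have le: "(\<Sum>(m, c)\<leftarrow>ds. ?s c) \<le> (\<Sum>(m, c)\<leftarrow>ds. Suc (num_edges c))"
      for ds :: "('a \<times> _) list"
      by (rule sum_list_mono) auto
    \<comment> \<open>The child \<open>c\<close> costs at most the edges below it, so the edge
      leading to \<open>c\<close> itself is saved.\<close>
    have "(\<Sum>(m, c)\<leftarrow>cs. ?s c) < (\<Sum>(m, c)\<leftarrow>cs. Suc (num_edges c))"
      using le[of cs1] le[of cs2] unfolding cs
      by (simp only: map_append list.map sum_list.append sum_list.Cons prod.case c(2) if_False)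
    \<comment> \<open>On \<open>cube n\<close> the default of the lookup is never reached, by
      \<open>dom\<close>.\<close>
    moreover have "hose_computable n (?F (Node P g cs)) (\<Sum>(m, c)\<leftarrow>cs. ?s c)"
      using hose_computable_lookup[of cs n ?F ?s g, OF child]
      by (rule hose_computable_cong) (use dom F in fastforce)+
    ultimately show ?thesis unfolding num_edges_Node by blast
  qed
qed

theorem theorem2:
  fixes n :: nat
    and f :: "bool list \<Rightarrow> bool list \<Rightarrow> bool"
    and T :: "'m protocol_tree"
  assumes "wf_tree n T"
    and "tree_computes n T f"
    and "T \<noteq> Leaf True"
  shows "GH n f \<le> num_edges T"
proof (rule GH_le)
  let ?f = "tree_output T"
  have "hose_computable n ?f (num_edges T)"
    using protocol_tree_slack[OF assms(1)]
  proof
    assume c: "constant_on_cube n ?f"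
    \<comment> \<open>Since the cube is inhabited, the constant false is not the constant true, and
      a well-formed inner node has an outgoing edge, which pays for the one pipe that the constant
      true needs.\<close>
    have ne: "replicate n False \<in> cube n" by (simp add: cube_def)
    show ?thesis
    proof (cases T)
      case (Leaf b)
      with assms(3) have "\<not> ?f x y" for x y by simp
      with ne have "\<not> (\<forall>x\<in>cube n. \<forall>y\<in>cube n. ?f x y)" by blast
      with hose_computable_constant[OF c] show ?thesis
        by (auto elim: hose_computable_mono)
    next
      case (Node P g cs)
      then have "cs \<noteq> []" using assms(1) ne by auto
      then have "1 \<le> num_edges T" using Node by (cases cs) auto
      with hose_computable_constant[OF c] show ?thesis
        by (auto elim: hose_computable_mono split: if_splits)
    qed
  next
    assume "\<exists>P s. s < num_edges T \<and> hose_computable n (oriented P ?f) s"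
    then obtain P s where "s < num_edges T" "hose_computable n (oriented P ?f) s" by blast
    \<comment> \<open>The slack covers the pipe that may be needed to hand the tap back to
      Alice.\<close>
    then have "hose_computable n (oriented Alice ?f) (num_edges T)"
      by (meson Suc_leI hose_computable_mono hose_computable_oriented)
    then show ?thesis by (rule hose_computable_cong) (simp add: oriented_def)
  qed
  then show "hose_computable n f (num_edges T)"
    by (rule hose_computable_cong) (use assms(2) in \<open>simp add: tree_computes_def\<close>)
qed

end
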